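(* For all integers $n\ge 1$, \[ b(n,1)=p(n,1)=2E(n-1,1). \] Moreover, there exists an explicit bijection between $B(n,1)$ and $P(n,1)$.
   Context: For a permutation $\pi=\pi_1\cdots\pi_n\in S_n$, a position $i\in\{1,\dots,n-1\}$ is an ascent if $\pi_i<\pi_{i+1}$ and a descent if $\pi_i>\pi_{i+1}$. The permutation $\pi$ is called ballot if for every $1\le k\le n-1$, the number of ascents among positions $1,\dots,k$ is at least the number of descents among positions $1,\dots,k$. Let $B(n,d)$ be the set of ballot permutations in $S_n$ with exactly $d$ descents and $b(n,d)=|B(n,d)|$. For a cycle $\mathfrak c=(c_1,\dots,c_k)$ of a permutation (fixed points are cycles of length 1), let $\mathrm{cA}(\mathfrak c)$ be the number of $i\in\{1,\dots,k\}$ with $c_i\le c_{i+1}$ and $\mathrm{cD}(\mathfrak c)$ the number with $c_i>c_{i+1}$, where $c_{k+1}=c_1$; let $M(\mathfrak c)=\min(\mathrm{cA}(\mathfrak c),\mathrm{cD}(\mathfrak c))$. For a permutation $\pi$ with cycles $\mathfrak c_1,\dots,\mathfrak c_m$, set $M(\pi)=\sum_i M(\mathfrak c_i)$. Let $P(n)$ be the set of permutations in $S_n$ of odd order (equivalently, all cycles have odd length), $P(n,d)=\{\pi\in P(n): M(\pi)=d\}$, and $p(n,d)=|P(n,d)|$. $E(n,d)$ denotes the Eulerian number: the number of permutations of $[n]$ with exactly $d$ descents, with $E(0,0)=1$ and $E(0,d)=0$ for $d\ge1$. *)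

theory Defs
  imports
    "HOL-Combinatorics.Cycles"
    "HOL-Algebra.Sym_Groups"
    "HOL-Algebra.Multiplicative_Group"
begin

definition ascents :: "nat \<Rightarrow> (nat \<Rightarrow> nat) \<Rightarrow> nat set" where
  "ascents n \<pi> = {i \<in> {1..<n}. \<pi> i < \<pi> (i + 1)}"

definition descents :: "nat \<Rightarrow> (nat \<Rightarrow> nat) \<Rightarrow> nat set" where
  "descents n \<pi> = {i \<in> {1..<n}. \<pi> i > \<pi> (i + 1)}"

definition ballot :: "nat \<Rightarrow> (nat \<Rightarrow> nat) \<Rightarrow> bool" where
  "ballot n \<pi> \<longleftrightarrow>
    (\<forall>k \<in> {1..<n}. card (ascents n \<pi> \<inter> {1..k}) \<ge> card (descents n \<pi> \<inter> {1..k}))"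

definition ballot_perms :: "nat \<Rightarrow> nat \<Rightarrow> (nat \<Rightarrow> nat) set" where
  "ballot_perms n d = {\<pi>. \<pi> permutes {1..n} \<and> ballot n \<pi> \<and> card (descents n \<pi>) = d}"

definition eulerian :: "nat \<Rightarrow> nat \<Rightarrow> nat" where
  "eulerian n d = card {\<pi>. \<pi> permutes {1..n} \<and> card (descents n \<pi>) = d}"

definition cyc_asc :: "nat list \<Rightarrow> nat" where
  "cyc_asc c = card {i. i < length c \<and> c ! i \<le> c ! (Suc i mod length c)}"

definition cyc_desc :: "nat list \<Rightarrow> nat" where
  "cyc_desc c = card {i. i < length c \<and> c ! i > c ! (Suc i mod length c)}"

definition cyc_M :: "nat list \<Rightarrow> nat" where
  "cyc_M c = min (cyc_asc c) (cyc_desc c)"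

text \<open>
  The list \<open>support \<pi> x\<close> is \<open>[x, \<pi> x, \<pi> (\<pi> x), \<dots>]\<close>, the cycle of \<open>\<pi>\<close> through \<open>x\<close> written
  starting from \<open>x\<close>. Each cycle, fixed points included, is represented exactly once, namely by
  the list starting with its least element.
\<close>

definition cycles_of :: "nat \<Rightarrow> (nat \<Rightarrow> nat) \<Rightarrow> nat list set" where
  "cycles_of n \<pi> = {support \<pi> x | x. x \<in> {1..n} \<and> x = Min (set (support \<pi> x))}"

definition perm_M :: "nat \<Rightarrow> (nat \<Rightarrow> nat) \<Rightarrow> nat" where
  "perm_M n \<pi> = (\<Sum>c \<in> cycles_of n \<pi>. cyc_M c)"

definition odd_order_perms :: "nat \<Rightarrow> (nat \<Rightarrow> nat) set" where
  "odd_order_perms n = {\<pi> \<in> carrier (sym_group n). odd (group.ord (sym_group n) \<pi>)}"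

definition odd_order_perms_M :: "nat \<Rightarrow> nat \<Rightarrow> (nat \<Rightarrow> nat) set" where
  "odd_order_perms_M n d = {\<pi> \<in> odd_order_perms n. perm_M n \<pi> = d}"

text \<open>
  An explicit bijection from the ballot permutations with one descent to the permutations of odd
  order with \<open>M = 1\<close>. The former are determined by the set \<open>A\<close> of entries of the first ascending
  run, which ranges over the sets with at least two elements that are not of the form \<open>{1..i}\<close>.
  The latter consist of a single non-trivial cycle, which runs either increasingly or decreasingly
  through a set of odd size at least 3.

  Sets \<open>A\<close> of odd size give increasing cycles, and sets \<open>A\<close> of even size give decreasing cycles on
  the symmetric difference of \<open>A\<close> and \<open>{1}\<close>. This is a bijection up to the sets
  \<open>A = {1, a}\<close> with \<open>a \<ge> 3\<close>, which would yield singletons, and the cycles not attained: the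
  increasing ones on \<open>{1..a}\<close> with \<open>a \<ge> 3\<close> odd, and the decreasing ones on \<open>{2..a}\<close> with
  \<open>a \<ge> 4\<close> even. These two leftover families are matched by means of \<open>a\<close>.
\<close>

definition first_run :: "nat \<Rightarrow> (nat \<Rightarrow> nat) \<Rightarrow> nat set" where
  "first_run n \<pi> = \<pi> ` {1..Min (descents n \<pi>)}"

definition inc_cycle :: "nat set \<Rightarrow> nat \<Rightarrow> nat" where
  "inc_cycle S = cycle_of_list (sorted_list_of_set S)"

definition dec_cycle :: "nat set \<Rightarrow> nat \<Rightarrow> nat" where
  "dec_cycle S = cycle_of_list (rev (sorted_list_of_set S))"

definition ballot_bij :: "nat \<Rightarrow> (nat \<Rightarrow> nat) \<Rightarrow> (nat \<Rightarrow> nat)" where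
  "ballot_bij n \<pi> =
    (let A = first_run n \<pi>; a = Max A in
      if odd (card A) then inc_cycle A
      else if A = {1, a} then (if odd a then inc_cycle {1..a} else dec_cycle {2..a})
      else dec_cycle ((A - {1}) \<union> ({1} - A)))"

end

theory Submission
  imports Defs
begin

text \<open>
  A permutation with exactly one descent is the increasing listing of a set \<open>A\<close> followed by that of
  its complement, and \<open>A\<close> may be any subset of \<open>{1..n}\<close> that is not of the form \<open>{1..k}\<close>; it is ballot
  iff \<open>A\<close> has at least two elements. On the other side, every cycle of length at least 2 has both an
  ascent and a descent, so \<open>M = 1\<close> forces a single non-trivial cycle. Written from its minimum
  (or from its maximum), its only descent (ascent) is the closing step, so the cycle is increasing
  (decreasing). Both sides thus become families of sets, which are matched and counted directly.
\<close>

section \<open>Orbits of permutations and the statistic M\<close>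

text \<open>The map \<open>i \<mapsto> (f ^^ i) x\<close> is injective below
  \<open>least_power f x\<close>, and passing to the cyclically next index applies \<open>f\<close>.
  Counts over positions thus become counts over orbit elements, which no longer depend on where the
  cycle is cut open.\<close>

lemma card_cyclic_pairs_support:
  assumes "permutation f"
  shows "card {i. i < length (support f x) \<and>
            P (support f x ! i) (support f x ! (Suc i mod length (support f x)))}
       = card {y \<in> set (support f x). P y (f y)}"
proof -
  let ?m = "least_power f x"
  note m = least_power_of_permutation[OF assms, of x]
  have inj: "inj_on (\<lambda>i. (f ^^ i) x) {0..<?m}"
    using cycle_of_permutation[OF assms, of x] by (simp add: distinct_map)
  have next_eq: "support f x ! (Suc i mod ?m) = f ((f ^^ i) x)" if "i < ?m" for i
  proof (cases "Suc i = ?m")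
    case True
    then have "f ((f ^^ i) x) = x" using m(1) by (metis funpow.simps(2) o_apply)
    then show ?thesis using True m(2) by simp
  next
    case False
    then show ?thesis using that by simp
  qed
  have "{y \<in> set (support f x). P y (f y)} = (\<lambda>i. (f ^^ i) x) ` {i. i < ?m \<and> P ((f ^^ i) x) (f ((f ^^ i) x))}"
    by auto
  moreover have "{i. i < length (support f x) \<and>
      P (support f x ! i) (support f x ! (Suc i mod length (support f x)))}
    = {i. i < ?m \<and> P ((f ^^ i) x) (f ((f ^^ i) x))}"
    using next_eq by auto
  moreover have "inj_on (\<lambda>i. (f ^^ i) x) {i. i < ?m \<and> P ((f ^^ i) x) (f ((f ^^ i) x))}"
    by (rule inj_on_subset[OF inj]) auto
  ultimately show ?thesis by (simp only: card_image)
qed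

lemma cyc_M_support:
  assumes "permutation f"
  shows "cyc_M (support f x) =
    min (card {y \<in> set (support f x). y \<le> f y}) (card {y \<in> set (support f x). f y < y})"
  unfolding cyc_M_def cyc_asc_def cyc_desc_def
  using card_cyclic_pairs_support[OF assms, where P = "\<lambda>a b. a \<le> b"]
    card_cyclic_pairs_support[OF assms, where P = "\<lambda>a b. b < a"] by simp

lemma in_support_self: "permutation f \<Longrightarrow> x \<in> set (support f x)"
  using least_power_of_permutation(2)[of f x] by force

lemma support_closed:
  assumes "permutation f" "y \<in> set (support f x)"
  shows "f y \<in> set (support f x)"
proof -
  obtain i where "y = (f ^^ i) x" using assms unfolding support_set[OF assms(1)] by blast
  then have "f y = (f ^^ Suc i) x" by simp
  then show ?thesis unfolding support_set[OF assms(1)] by blast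
qed

lemma support_eqI:
  assumes "permutation f" "y \<in> set (support f x)"
  shows "set (support f y) = set (support f x)"
  using disjoint_support[OF assms(1)] in_support_self[OF assms(1), of y] assms(2)
  unfolding disjoint_def by blast

lemma support_fixed:
  assumes "f x = x"
  shows "support f x = [x]"
proof -
  have "least_power f x = 1"
    unfolding least_power_def by (rule Least_equality) (use assms in auto)
  then show ?thesis by simp
qed

section \<open>Cycles built from lists\<close>

lemma cycle_of_list_nth:
  assumes "distinct cs" "i < length cs"
  shows "cycle_of_list cs (cs ! i) = cs ! (Suc i mod length cs)"
proof -
  have "map (cycle_of_list cs) cs = rotate1 cs"
    using cyclic_rotation[OF assms(1), of 1] by simp
  then show ?thesis using assms(2) by (metis nth_map nth_rotate1)
qed

text \<open>The \<open>k\<close>-th power of the cycle acts on the list as rotation by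
  \<open>k\<close>, so the orbit of any entry runs through all entries.\<close>

lemma support_cycle_of_list:
  assumes "distinct cs" "x \<in> set cs"
  shows "set (support (cycle_of_list cs) x) = set cs"
proof -
  let ?f = "cycle_of_list cs"
  obtain i where i: "i < length cs" "x = cs ! i" using assms(2) by (metis in_set_conv_nth)
  have pow: "(?f ^^ k) x = cs ! ((k + i) mod length cs)" for k
    using cyclic_rotation[OF assms(1), of k] i by (metis nth_map nth_rotate)
  have "cs ! j \<in> range (\<lambda>k. (?f ^^ k) x)" if "j < length cs" for j
    \<comment> \<open>Adding \<open>length cs\<close> keeps the exponent natural when
      \<open>j < i\<close>; together with the offset \<open>i\<close> it is \<open>j\<close> modulo
      the length.\<close>
    by (rule range_eqI[of _ _ "length cs - i + j"]) (use i that pow in simp)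
  moreover have "(?f ^^ k) x \<in> set cs" for k
    unfolding pow using i(1) by (intro nth_mem mod_less_divisor) linarith
  ultimately show ?thesis
    unfolding support_set[OF permutation_of_cycle] by (auto simp: in_set_conv_nth)
qed

text \<open>This recovers the support of a cycle from the function alone, which gives the
  injectivity of \<open>inc_cycle\<close> and \<open>dec_cycle\<close>.\<close>

lemma moved_points_cycle_of_list:
  assumes "distinct cs" "2 \<le> length cs"
  shows "{x. cycle_of_list cs x \<noteq> x} = set cs"
proof -
  have "cs ! (Suc i mod length cs) \<noteq> cs ! i" if "i < length cs" for i
    using assms that by (subst nth_eq_iff_index_eq) (auto simp: mod_Suc)
  then have "cycle_of_list cs x \<noteq> x" if "x \<in> set cs" for x
    using that assms(1) by (auto simp: in_set_conv_nth cycle_of_list_nth)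
  moreover have "cycle_of_list cs x = x" if "x \<notin> set cs" for x
    using that by (rule id_outside_supp)
  ultimately show ?thesis by auto
qed

text \<open>Only the closing step, from the last entry back to the first, goes against
  \<open>R\<close>. The relation is kept abstract to serve both \<open><\<close> (increasing cycles)
  and \<open>>\<close> (decreasing cycles).\<close>

lemma unique_drop_of_sorted_cycle:
  assumes "transp R" "asymp R" "sorted_wrt R cs" "distinct cs" "2 \<le> length cs"
  shows "card {y \<in> set cs. R (cycle_of_list cs y) y} = 1"
proof -
  have ne: "cs \<noteq> []" using assms(5) by auto
  have last: "last cs = cs ! (length cs - 1)" using ne by (rule last_conv_nth)
  have "R (cycle_of_list cs (cs ! i)) (cs ! i) \<longleftrightarrow> i = length cs - 1" if "i < length cs" for i
  proof (cases "Suc i = length cs")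
    case True
    then have "R (cs ! 0) (cs ! i)"
      using assms(3,5) that by (auto simp: sorted_wrt_iff_nth_less)
    with True show ?thesis using that assms(4) by (auto simp: cycle_of_list_nth)
  next
    case False
    then have "R (cs ! i) (cs ! Suc i)"
      using assms(3) that by (auto simp: sorted_wrt_iff_nth_less)
    then have "\<not> R (cs ! Suc i) (cs ! i)" using assms(2) by (meson asympD)
    then show ?thesis using False that assms(4) by (auto simp: cycle_of_list_nth)
  qed
  then have "{y \<in> set cs. R (cycle_of_list cs y) y} = {last cs}"
    using ne unfolding last
    by (auto simp: in_set_conv_nth intro!: exI[of _ "length cs - Suc 0"])
  then show ?thesis by simp
qed

text \<open>
  The last element of the list is mapped to the \<open>R\<close>-least element \<open>x\<close>, hence it is the unique drop.
\<close>

lemma sorted_support_of_unique_drop: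
  assumes "permutation f" "transp R" "totalp R"
    and min: "\<And>y. y \<in> set (support f x) \<Longrightarrow> y \<noteq> x \<Longrightarrow> R x y"
    and moved: "f x \<noteq> x"
    and card: "card {y \<in> set (support f x). R (f y) y} = 1"
  shows "sorted_wrt R (support f x)"
  unfolding sorted_wrt_iff_nth_Suc_transp[OF assms(2)]
proof (intro allI impI)
  let ?m = "least_power f x"
  define l where "l = (f ^^ (?m - 1)) x"
  note m = least_power_of_permutation[OF assms(1), of x]
  have m2: "?m > 1" using least_power_gt_one[OF assms(1) moved] by simp
  have fl: "f l = x" unfolding l_def using m by (metis Suc_diff_1 funpow.simps(2) o_apply)
  have lin: "l \<in> set (support f x)" unfolding l_def using m2 by auto
  have "l \<noteq> x" using fl moved by metis
  then have "l \<in> {y \<in> set (support f x). R (f y) y}" using min[OF lin] fl lin by auto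
  then have only: "{y \<in> set (support f x). R (f y) y} = {l}"
    using card by (metis card_1_singletonE singletonD)
  fix i assume "Suc i < length (support f x)"
  then have i: "Suc i < ?m" by simp
  let ?y = "(f ^^ i) x"
  have y: "?y \<in> set (support f x)" using i by auto
  have d: "(f ^^ i) x = (f ^^ j) x \<Longrightarrow> i = j" if "i < ?m" "j < ?m" for i j
    using cycle_of_permutation[OF assms(1), of x] that by (auto simp: distinct_map inj_on_def)
  \<comment> \<open>As \<open>Suc i < ?m\<close>, the step out of \<open>?y\<close> is not the
    closing one, hence not a drop; totality of \<open>R\<close> then orients it forwards.\<close>
  have "?y \<noteq> l" unfolding l_def using d[of i "?m - 1"] i by auto
  then have "\<not> R (f ?y) ?y" using only y by blast
  moreover have "f ?y \<noteq> ?y" using d[of i "Suc i"] i by auto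
  ultimately have "R ?y (f ?y)" using assms(3) by (metis totalpD)
  then show "R (support f x ! i) (support f x ! Suc i)" using i by simp
qed

section \<open>Odd order in terms of powers\<close>

lemma funpow_sym_group: "f [^]\<^bsub>sym_group n\<^esub> (m::nat) = f ^^ m"
proof -
  interpret group "sym_group n" by (rule sym_group_is_group)
  show ?thesis
    by (induction m) (simp_all add: sym_group_one sym_group_mult funpow_Suc_right del: funpow.simps(2))
qed

text \<open>The order divides every exponent that yields the identity, and a divisor of an odd
  number is odd. Conversely, the order itself is such an exponent.\<close>

lemma mem_odd_order_perms_iff:
  "f \<in> odd_order_perms n \<longleftrightarrow> f permutes {1..n} \<and> (\<exists>m. odd m \<and> f ^^ m = id)"
proof -
  interpret group "sym_group n" by (rule sym_group_is_group)
  have "(\<exists>m. odd m \<and> f ^^ m = id) \<longleftrightarrow> odd (ord f)" if "f \<in> carrier (sym_group n)"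
    using pow_eq_id[OF that] unfolding funpow_sym_group sym_group_one
    by (metis dvd_refl dvd_trans)
  then show ?thesis unfolding odd_order_perms_def sym_group_carrier[symmetric] by auto
qed

section \<open>Permutations of odd order with M = 1\<close>

definition odd_sets :: "nat \<Rightarrow> nat set set" where
  "odd_sets n = {S. S \<subseteq> {1..n} \<and> odd (card S) \<and> 3 \<le> card S}"

lemma card_excedances_add_anti_excedances:
  fixes f :: "nat \<Rightarrow> nat"
  assumes "finite S"
  shows "card {y \<in> S. y \<le> f y} + card {y \<in> S. f y < y} = card S"
  using assms by (subst card_Un_disjoint[symmetric]) (auto intro!: arg_cong[where f = card])

text \<open>The only cyclic step compares the entry with itself, which is never a descent.\<close>

lemma cyc_M_singleton: "cyc_M [x] = 0"
proof -
  have no_drop: "{i. i < length [x] \<and> [x] ! (Suc i mod length [x]) < [x] ! i} = {}" by auto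
  show ?thesis unfolding cyc_M_def cyc_desc_def no_drop by simp
qed

lemma cycles_of_memE:
  assumes "c \<in> cycles_of n f"
  obtains x where "x \<in> {1..n}" "x = Min (set (support f x))" "c = support f x"
  using assms that unfolding cycles_of_def mem_Collect_eq by (elim exE conjE) metis

text \<open>All other cycles are fixed points and contribute 0. On \<open>set cs\<close> one of the
  two counts is 1 and the other is \<open>card (set cs) - 1\<close>, at least 2, so the minimum is
  1. The disjunction admits increasing and decreasing cycles alike.\<close>

lemma cycle_of_list_in_odd_order_perms_M:
  assumes "distinct cs" "set cs \<in> odd_sets n"
    and one: "card {y \<in> set cs. cycle_of_list cs y < y} = 1 \<or> card {y \<in> set cs. y \<le> cycle_of_list cs y} = 1"
  shows "cycle_of_list cs \<in> odd_order_perms_M n 1"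
proof -
  let ?f = "cycle_of_list cs" and ?S = "set cs"
  have S: "?S \<subseteq> {1..n}" "odd (card ?S)" "3 \<le> card ?S" using assms(2) by (auto simp: odd_sets_def)
  have ne: "?S \<noteq> {}" using S by auto
  note perm = permutation_of_cycle[of cs]
  have "?f permutes {1..n}" using cycle_permutes S(1) by (rule permutes_subset)
  moreover have "?f ^^ card ?S = id" using cycle_is_id_root[OF assms(1)] distinct_card[OF assms(1)] by simp
  ultimately have odd: "?f \<in> odd_order_perms n" using S(2) mem_odd_order_perms_iff by blast
  \<comment> \<open>\<open>cycles_of\<close> writes each orbit from its minimum, however
    \<open>cs\<close> is ordered.\<close>
  let ?c = "support ?f (Min ?S)"
  have supp: "set ?c = ?S" using support_cycle_of_list[OF assms(1)] ne by (meson Min_in List.finite_set)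
  have "?c \<in> cycles_of n ?f"
    unfolding cycles_of_def using supp S(1) Min_in[OF _ ne] by force
  moreover have "cyc_M c = 0" if c: "c \<in> cycles_of n ?f - {?c}" for c
  proof -
    obtain x where x: "c = support ?f x" "x = Min (set (support ?f x))"
      using c by (auto elim: cycles_of_memE)
    have "c \<noteq> ?c" using c by simp
    then have "x \<notin> ?S" using support_cycle_of_list[OF assms(1)] x by metis
    then have "c = [x]" using x(1) support_fixed id_outside_supp by metis
    then show ?thesis by (simp add: cyc_M_singleton)
  qed
  moreover have "finite (cycles_of n ?f)" unfolding cycles_of_def by simp
  ultimately have "perm_M n ?f = cyc_M ?c"
    unfolding perm_M_def by (subst sum.mono_neutral_right[of _ "{?c}"]) auto
  also have "\<dots> = 1"
    using one card_excedances_add_anti_excedances[of ?S ?f] S(3)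
    unfolding cyc_M_support[OF perm] supp by auto
  finally show ?thesis using odd by (simp add: odd_order_perms_M_def)
qed

lemma inc_cycle_unique_drop:
  assumes "finite S" "2 \<le> card S"
  shows "card {y \<in> S. inc_cycle S y < y} = 1"
  using unique_drop_of_sorted_cycle[of "(<)" "sorted_list_of_set S"] assms
  by (simp add: inc_cycle_def)

lemma moved_points_inc_cycle:
  assumes "finite S" "2 \<le> card S"
  shows "{x. inc_cycle S x \<noteq> x} = S"
  using moved_points_cycle_of_list[of "sorted_list_of_set S"] assms
  by (simp add: inc_cycle_def)

lemma moved_points_dec_cycle:
  assumes "finite S" "2 \<le> card S"
  shows "{x. dec_cycle S x \<noteq> x} = S"
  using moved_points_cycle_of_list[of "rev (sorted_list_of_set S)"] assms
  by (simp add: dec_cycle_def)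

lemma dec_cycle_unique_rise:
  assumes "finite S" "2 \<le> card S"
  shows "card {y \<in> S. y \<le> dec_cycle S y} = 1"
proof -
  \<comment> \<open>Every point of \<open>S\<close> is moved, so the weak rises counted by
    \<open>cyc_asc\<close> are strict and form the drops for \<open>R = (>)\<close>.\<close>
  have "{y \<in> S. y \<le> dec_cycle S y} = {y \<in> S. y < dec_cycle S y}"
    using moved_points_dec_cycle[OF assms] by (metis (mono_tags, lifting) mem_Collect_eq order_le_less)
  then show ?thesis
    using unique_drop_of_sorted_cycle[of "(>)" "rev (sorted_list_of_set S)"] assms
    by (simp add: dec_cycle_def sorted_wrt_rev)
qed

lemma odd_setsD:
  assumes "S \<in> odd_sets n"
  shows "finite S" "2 \<le> card S" "3 \<le> card S"
  using assms by (auto simp: odd_sets_def intro: finite_subset)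

text \<open>Equal cycles have equal supports. One drop and one weak rise together would then exhaust
  the support, although it has at least 3 elements.\<close>

lemma inc_cycle_neq_dec_cycle:
  assumes "S \<in> odd_sets n" "T \<in> odd_sets n"
  shows "inc_cycle S \<noteq> dec_cycle T"
proof
  assume eq: "inc_cycle S = dec_cycle T"
  note S = odd_setsD[OF assms(1)] and T = odd_setsD[OF assms(2)]
  have "S = T" using moved_points_inc_cycle[OF S(1,2)] moved_points_dec_cycle[OF T(1,2)] eq by simp
  then show False
    using inc_cycle_unique_drop[OF S(1,2)] dec_cycle_unique_rise[OF T(1,2)] eq S(3)
      card_excedances_add_anti_excedances[OF S(1), of "inc_cycle S"] by simp
qed

lemma inj_on_inc_cycle: "inj_on inc_cycle (odd_sets n)"
  by (rule inj_onI) (metis moved_points_inc_cycle odd_setsD(1,2))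

lemma inj_on_dec_cycle: "inj_on dec_cycle (odd_sets n)"
  by (rule inj_onI) (metis moved_points_dec_cycle odd_setsD(1,2))

text \<open>On a non-trivial orbit the maximum is mapped strictly down and the minimum is not mapped
  down, so both counts are positive.\<close>

lemma cyc_M_support_pos:
  assumes "permutation f" "f (x::nat) \<noteq> x"
  shows "cyc_M (support f x) > 0"
proof -
  let ?C = "set (support f x)"
  have ne: "?C \<noteq> {}" using in_support_self[OF assms(1)] by (metis empty_iff)
  have fin: "finite ?C" by simp
  \<comment> \<open>A fixed point in the orbit would be the whole orbit, contradicting that
    \<open>x\<close> is moved.\<close>
  have "f y \<noteq> y" if "y \<in> ?C" for y
    using support_eqI[OF assms(1) that] support_fixed[of f y] in_support_self[OF assms(1), of x]
      support_closed[OF assms(1) in_support_self[OF assms(1), of x]] assms(2) by fastforce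
  then have "f (Max ?C) < Max ?C"
    using support_closed[OF assms(1)] Max_in[OF fin ne] Max_ge[OF fin] by (metis order_le_less)
  then have "{y \<in> ?C. f y < y} \<noteq> {}" using Max_in[OF fin ne] by blast
  moreover have "Min ?C \<le> f (Min ?C)"
    using support_closed[OF assms(1)] Min_in[OF fin ne] Min_le[OF fin] by blast
  then have "{y \<in> ?C. y \<le> f y} \<noteq> {}" using Min_in[OF fin ne] by blast
  moreover have "finite {y \<in> ?C. f y < y}" "finite {y \<in> ?C. y \<le> f y}" by auto
  ultimately show ?thesis unfolding cyc_M_support[OF assms(1)] by (simp add: card_gt_0_iff)
qed

lemma eq_cycle_of_support:
  assumes "permutation f" "\<And>y. y \<notin> set (support f x) \<Longrightarrow> f y = y"
  shows "f = cycle_of_list (support f x)"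
proof
  fix y show "f y = cycle_of_list (support f x) y"
  proof (cases "y \<in> set (support f x)")
    case True then show ?thesis by (rule cycle_restrict[OF assms(1)])
  next
    case False then show ?thesis using assms(2) id_outside_supp by metis
  qed
qed

text \<open>A sum of naturals equal to 1 has one term 1 and all others 0. Terms of non-trivial
  cycles are positive, so only one cycle moves points; its minimum count being 1 makes it monotone
  up to the closing step.\<close>

lemma odd_order_perms_M_1_cases:
  assumes "f \<in> odd_order_perms_M n 1"
  shows "f \<in> inc_cycle ` odd_sets n \<union> dec_cycle ` odd_sets n"
proof -
  obtain m where f: "f permutes {1..n}" and m: "odd m" "f ^^ m = id" and M: "perm_M n f = 1"
    using assms unfolding odd_order_perms_M_def mem_odd_order_perms_iff by blast
  have perm: "permutation f" using f permutation_permutes by blast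
  have sub: "set (support f x) \<subseteq> {1..n}" if "x \<in> {1..n}" for x
    using permutes_in_image[OF permutes_funpow[OF f]] that by auto
  have "finite (cycles_of n f)" unfolding cycles_of_def by simp
  then obtain c where c: "c \<in> cycles_of n f" "cyc_M c = 1"
    and others: "\<And>c'. c' \<in> cycles_of n f \<Longrightarrow> c' \<noteq> c \<Longrightarrow> cyc_M c' = 0"
    using M unfolding perm_M_def by (auto simp: sum_eq_Suc0_iff)
  obtain x where x: "x \<in> {1..n}" "x = Min (set (support f x))" and cx: "c = support f x"
    using c(1) by (rule cycles_of_memE)
  let ?C = "set (support f x)"
  have fin: "finite ?C" and ne: "?C \<noteq> {}" using in_support_self[OF perm, of x] by auto
  \<comment> \<open>The orbit of \<open>y\<close> enters the sum through its minimum
    \<open>z\<close>. Its contribution is 0, so \<open>z\<close> is fixed and the orbit is a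
    singleton.\<close>
  have fixed: "f y = y" if "y \<notin> ?C" for y
  proof (cases "y \<in> {1..n}")
    case True
    let ?D = "set (support f y)"
    define z where "z = Min ?D"
    have z: "z \<in> ?D" unfolding z_def using in_support_self[OF perm, of y] by (intro Min_in) auto
    then have eq: "set (support f z) = ?D" by (rule support_eqI[OF perm])
    have "z \<in> {1..n}" using z sub[OF True] by blast
    then have "support f z \<in> cycles_of n f" unfolding cycles_of_def using eq z_def by auto
    moreover have "support f z \<noteq> c" using eq in_support_self[OF perm, of y] that cx by metis
    ultimately have "cyc_M (support f z) = 0" by (rule others)
    then have "f z = z" using cyc_M_support_pos[OF perm, of z] by fastforce
    then have "?D = {z}" using eq support_fixed[of f z] by simp
    then show ?thesis using \<open>f z = z\<close> in_support_self[OF perm, of y] by simp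
  next
    case False
    then show ?thesis using f by (simp add: permutes_def)
  qed
  have moved: "f y \<noteq> y" if "y \<in> ?C" for y
  proof
    assume "f y = y"
    then have "?C = {y}" using support_eqI[OF perm that] support_fixed[of f y] by simp
    then have "x = y" using in_support_self[OF perm, of x] by simp
    then have "cyc_M c = 0" using cx support_fixed[of f y] \<open>f y = y\<close> by (simp add: cyc_M_singleton)
    then show False using c(2) by simp
  qed
  have card: "card ?C = least_power f x" using distinct_card[OF cycle_of_permutation[OF perm, of x]] by simp
  \<comment> \<open>The length of the cycle divides the odd exponent \<open>m\<close>, hence is
    odd.\<close>
  have "least_power f x dvd m" using least_power_minimal[of m f x] m(2) by simp
  then have odd: "odd (card ?C)" using m(1) card dvd_trans by metis
  have "card ?C > 1" using least_power_gt_one[OF perm moved] in_support_self[OF perm, of x] card by simp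
  with odd have C: "?C \<in> odd_sets n"
    using sub[OF x(1)] unfolding odd_sets_def by (cases "card ?C = 2") auto
  consider "card {y \<in> ?C. f y < y} = 1" | "card {y \<in> ?C. y \<le> f y} = 1"
    using c(2) unfolding cx cyc_M_support[OF perm] by linarith
  then show ?thesis
  proof cases
    case 1
    have "sorted_wrt (<) (support f x)"
    proof (rule sorted_support_of_unique_drop[OF perm])
      show "x < y" if "y \<in> ?C" "y \<noteq> x" for y
        using Min_le[OF fin that(1)] x(2) that(2) by linarith
      show "f x \<noteq> x" using moved in_support_self[OF perm, of x] by blast
    qed (use 1 in simp_all)
    then have "support f x = sorted_list_of_set ?C"
      by (intro strict_sorted_equal[symmetric]) auto
    then have "f = inc_cycle ?C" using eq_cycle_of_support[OF perm fixed] by (simp only: inc_cycle_def)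
    then show ?thesis using C by blast
  next
    case 2
    \<comment> \<open>For \<open>R = (>)\<close> the listing must start at the
      \<open>R\<close>-least element, which is the maximum rather than \<open>x\<close>.\<close>
    define z where "z = Max ?C"
    have z: "z \<in> ?C" unfolding z_def by (rule Max_in[OF fin ne])
    then have eq: "set (support f z) = ?C" by (rule support_eqI[OF perm])
    have "sorted_wrt (>) (support f z)"
    proof (rule sorted_support_of_unique_drop[OF perm])
      show "z > y" if "y \<in> set (support f z)" "y \<noteq> z" for y
        using Max_ge[OF fin, of y] that eq unfolding z_def by fastforce
      show "f z \<noteq> z" using moved z by blast
      have "{y \<in> ?C. y < f y} = {y \<in> ?C. y \<le> f y}" using moved by (metis (mono_tags, lifting) order_le_less)
      then show "card {y \<in> set (support f z). f y > y} = 1" using 2 eq by simp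
    qed simp_all
    then have "sorted_wrt (<) (rev (support f z))" by (subst sorted_wrt_rev) simp
    then have "rev (support f z) = sorted_list_of_set ?C"
      using eq by (intro strict_sorted_equal[symmetric]) (simp_all only: set_rev set_sorted_list_of_set[OF fin] strict_sorted_list_of_set)
    then have "support f z = rev (sorted_list_of_set ?C)" by (metis rev_rev_ident)
    moreover have "f = cycle_of_list (support f z)"
      by (rule eq_cycle_of_support[OF perm]) (use fixed eq in metis)
    ultimately have "f = dec_cycle ?C" by (simp only: dec_cycle_def)
    then show ?thesis using C by blast
  qed
qed

lemma odd_order_perms_M_1_eq:
  "odd_order_perms_M n 1 = inc_cycle ` odd_sets n \<union> dec_cycle ` odd_sets n"
proof
  show "odd_order_perms_M n 1 \<subseteq> inc_cycle ` odd_sets n \<union> dec_cycle ` odd_sets n"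
    using odd_order_perms_M_1_cases by blast
  have "inc_cycle S \<in> odd_order_perms_M n 1" if "S \<in> odd_sets n" for S
    using cycle_of_list_in_odd_order_perms_M[of "sorted_list_of_set S" n] that
      inc_cycle_unique_drop odd_setsD[OF that] by (simp add: inc_cycle_def)
  moreover have "dec_cycle S \<in> odd_order_perms_M n 1" if "S \<in> odd_sets n" for S
    using cycle_of_list_in_odd_order_perms_M[of "rev (sorted_list_of_set S)" n] that
      dec_cycle_unique_rise odd_setsD[OF that] by (simp add: dec_cycle_def)
  ultimately show "inc_cycle ` odd_sets n \<union> dec_cycle ` odd_sets n \<subseteq> odd_order_perms_M n 1"
    by blast
qed

section \<open>Permutations with one descent\<close>

text \<open>These are the sets for which listing \<open>A\<close> and then its complement, both
  increasingly, does not give the identity word. Comparing with \<open>{1..card A}\<close> alone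
  suffices, since cardinality determines the prefix; the empty set and \<open>{1..n}\<close> are
  excluded too.\<close>

definition non_prefix_sets :: "nat \<Rightarrow> nat set set" where
  "non_prefix_sets n = {A. A \<subseteq> {1..n} \<and> A \<noteq> {1..card A}}"

definition one_descent_perms :: "nat \<Rightarrow> (nat \<Rightarrow> nat) set" where
  "one_descent_perms n = {\<pi>. \<pi> permutes {1..n} \<and> card (descents n \<pi>) = 1}"

lemma sorted_map_upt_of_ascents:
  fixes \<pi> :: "nat \<Rightarrow> nat"
  assumes "\<And>i. a \<le> i \<Longrightarrow> Suc i < b \<Longrightarrow> \<pi> i < \<pi> (Suc i)"
  shows "sorted_wrt (<) (map \<pi> [a..<b])"
  unfolding sorted_wrt_iff_nth_Suc_transp[OF transp_on_less]
  using assms by auto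

lemma one_descent_permsE:
  assumes "\<pi> \<in> one_descent_perms n"
  obtains k where "\<pi> permutes {1..n}" "descents n \<pi> = {k}" "1 \<le> k" "k < n"
    "first_run n \<pi> = \<pi> ` {1..k}" "card (first_run n \<pi>) = k"
    "\<forall>i. 1 \<le> i \<and> i < n \<and> i \<noteq> k \<longrightarrow> \<pi> i < \<pi> (Suc i)"
proof -
  have perm: "\<pi> permutes {1..n}" and "card (descents n \<pi>) = 1"
    using assms by (auto simp: one_descent_perms_def)
  then obtain k where k: "descents n \<pi> = {k}" by (meson card_1_singletonE)
  then have "k \<in> descents n \<pi>" by simp
  then have kn: "1 \<le> k" "k < n" by (auto simp: descents_def)
  have run: "first_run n \<pi> = \<pi> ` {1..k}" by (simp add: first_run_def k)
  have "inj \<pi>" using perm by (rule permutes_inj)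
  then have card: "card (first_run n \<pi>) = k" unfolding run by (simp add: card_image inj_on_subset)
  have "\<pi> i < \<pi> (Suc i)" if "1 \<le> i" "i < n" "i \<noteq> k" for i
  proof -
    have "i \<notin> descents n \<pi>" using k that by simp
    moreover have "\<pi> i \<noteq> \<pi> (Suc i)" using \<open>inj \<pi>\<close> by (simp add: inj_eq)
    ultimately show ?thesis using that by (simp add: descents_def)
  qed
  with perm k kn run card show thesis by (intro that) auto
qed

text \<open>The word is strictly increasing on both sides of the descent, and a strictly increasing
  list is determined by its set. Hence \<open>first_run\<close> determines the permutation.\<close>

lemma one_descent_perm_word:
  assumes "\<pi> \<in> one_descent_perms n"
  shows "map \<pi> [1..<Suc n] =
    sorted_list_of_set (first_run n \<pi>) @ sorted_list_of_set ({1..n} - first_run n \<pi>)"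
proof -
  obtain k where k: "\<pi> permutes {1..n}" "descents n \<pi> = {k}" "1 \<le> k" "k < n" "first_run n \<pi> = \<pi> ` {1..k}"
      "card (first_run n \<pi>) = k"
    and asc: "\<forall>i. 1 \<le> i \<and> i < n \<and> i \<noteq> k \<longrightarrow> \<pi> i < \<pi> (Suc i)"
    using assms by (rule one_descent_permsE)
  have "[1..<Suc n] = [1..<Suc k] @ [Suc k..<Suc n]"
    using k(3,4) upt_add_eq_append[of 1 "Suc k" "n - k"] by simp
  then have split: "map \<pi> [1..<Suc n] = map \<pi> [1..<Suc k] @ map \<pi> [Suc k..<Suc n]" by (simp only: map_append)
  have "{1..n} - \<pi> ` {1..k} = \<pi> ` ({1..n} - {1..k})"
    using permutes_image[OF k(1)] permutes_inj[OF k(1)] by (simp add: image_set_diff)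
  also have "{1..n} - {1..k} = {Suc k..<Suc n}" by auto
  finally have rest: "{1..n} - first_run n \<pi> = \<pi> ` {Suc k..<Suc n}" using k(5) by simp
  have run: "first_run n \<pi> = \<pi> ` {1..<Suc k}" using k(5) by (simp add: atLeastLessThanSuc_atLeastAtMost)
  have "sorted_wrt (<) (map \<pi> [1..<Suc k])"
    by (rule sorted_map_upt_of_ascents) (use asc k in auto)
  then have "map \<pi> [1..<Suc k] = sorted_list_of_set (first_run n \<pi>)"
    by (intro strict_sorted_equal) (simp_all add: run del: upt_Suc)
  moreover have "sorted_wrt (<) (map \<pi> [Suc k..<Suc n])"
    by (rule sorted_map_upt_of_ascents) (use asc k in auto)
  then have "map \<pi> [Suc k..<Suc n] = sorted_list_of_set ({1..n} - first_run n \<pi>)"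
    by (intro strict_sorted_equal) (simp_all only: rest set_map set_upt strict_sorted_list_of_set set_sorted_list_of_set finite_imageI finite_atLeastLessThan)
  ultimately show ?thesis using split by simp
qed

lemma first_run_in_non_prefix_sets:
  assumes "\<pi> \<in> one_descent_perms n"
  shows "first_run n \<pi> \<in> non_prefix_sets n"
proof -
  obtain k where k: "\<pi> permutes {1..n}" "descents n \<pi> = {k}" "1 \<le> k" "k < n" "first_run n \<pi> = \<pi> ` {1..k}"
      "card (first_run n \<pi>) = k"
    and asc: "\<forall>i. 1 \<le> i \<and> i < n \<and> i \<noteq> k \<longrightarrow> \<pi> i < \<pi> (Suc i)"
    using assms by (rule one_descent_permsE)
  have "first_run n \<pi> \<subseteq> {1..n}"
    unfolding k(5) using permutes_in_image[OF k(1)] k(4) by fastforce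
  \<comment> \<open>If the first \<open>k\<close> values were \<open>{1..k}\<close>, the next value
    would exceed them all, and \<open>k\<close> would be an ascent.\<close>
  moreover have "first_run n \<pi> \<noteq> {1..k}"
  proof
    assume eq: "first_run n \<pi> = {1..k}"
    have "\<pi> k \<in> \<pi> ` {1..k}" using k(3) by simp
    moreover have "\<pi> (Suc k) \<notin> \<pi> ` {1..k}" using permutes_inj[OF k(1)] by (auto simp: inj_eq)
    moreover have "\<pi> (Suc k) \<in> {1..n}" using permutes_in_image[OF k(1)] k(4) by simp
    ultimately have "\<pi> k < \<pi> (Suc k)" using eq k(5) by auto
    moreover have "k \<in> descents n \<pi>" using k(2) by simp
    ultimately show False by (simp add: descents_def)
  qed
  ultimately show ?thesis using k(6) by (simp add: non_prefix_sets_def)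
qed

lemma non_prefix_set_is_first_run:
  assumes "A \<in> non_prefix_sets n"
  shows "\<exists>\<pi> \<in> one_descent_perms n. first_run n \<pi> = A"
proof -
  have A: "A \<subseteq> {1..n}" "A \<noteq> {1..card A}" using assms by (auto simp: non_prefix_sets_def)
  have fin: "finite A" using A(1) finite_subset by blast
  define k where "k = card A"
  define xs where "xs = sorted_list_of_set A @ sorted_list_of_set ({1..n} - A)"
  \<comment> \<open>Positions count from 1 and list indices from 0; outside \<open>{1..n}\<close>
    the identity is needed for \<open>permutes\<close>.\<close>
  define \<pi> where "\<pi> = (\<lambda>i. if i \<in> {1..n} then xs ! (i - 1) else i)"
  have set: "set xs = {1..n}" using A(1) fin by (auto simp: xs_def)
  have dist: "distinct xs" using fin by (auto simp: xs_def)
  have len: "length xs = n" using distinct_card[OF dist] set by simp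
  have word: "map \<pi> [1..<Suc n] = xs"
    by (rule nth_equalityI) (auto simp: \<pi>_def len simp del: upt_Suc)
  have "set (map \<pi> [1..<Suc n]) = {1..n}" "distinct (map \<pi> [1..<Suc n])"
    unfolding word by (fact set dist)+
  then have "bij_betw \<pi> {1..n} {1..n}"
    by (simp add: bij_betw_def distinct_map atLeastLessThanSuc_atLeastAtMost del: upt_Suc)
  then have perm: "\<pi> permutes {1..n}" by (rule bij_imp_permutes) (simp only: \<pi>_def if_False)
  have kn: "k \<le> n" unfolding k_def using card_mono[OF _ A(1)] by simp
  have asc: "\<pi> i < \<pi> (Suc i)" if "1 \<le> i" "i < n" "i \<noteq> k" for i
  proof (cases "i < k")
    case True
    then have "sorted_list_of_set A ! (i - 1) < sorted_list_of_set A ! i"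
      using sorted_wrt_nth_less[OF strict_sorted_list_of_set, of "i - 1" i A] that
      by (simp add: k_def)
    moreover have "i - 1 < card A" using True unfolding k_def by linarith
    ultimately show ?thesis using True that by (simp add: \<pi>_def xs_def nth_append k_def)
  next
    case False
    \<comment> \<open>Here \<open>k < i\<close>, so positions \<open>i\<close> and
      \<open>Suc i\<close> both lie in the second block, at indices \<open>i - 1 - k\<close> and
      \<open>i - k\<close>.\<close>
    have "length (sorted_list_of_set ({1..n} - A)) = n - k"
      using len by (simp add: xs_def k_def)
    then have "sorted_list_of_set ({1..n} - A) ! (i - 1 - k) < sorted_list_of_set ({1..n} - A) ! (i - k)"
      using sorted_wrt_nth_less[OF strict_sorted_list_of_set, of "i - 1 - k" "i - k" "{1..n} - A"] that False
      by simp
    moreover have "\<not> i - 1 < card A" using False that unfolding k_def by linarith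
    ultimately show ?thesis using False that by (simp add: \<pi>_def xs_def nth_append k_def)
  qed
  have run: "\<pi> ` {1..k} = A"
  proof -
    have "\<pi> ` {1..k} = set (take k (map \<pi> [1..<Suc n]))"
      using kn by (simp add: take_map take_upt atLeastLessThanSuc_atLeastAtMost del: upt_Suc)
    also have "\<dots> = A" unfolding word using fin by (simp add: xs_def k_def)
    finally show ?thesis .
  qed
  have "descents n \<pi> \<subseteq> {k}" using asc by (force simp: descents_def)
  moreover have "descents n \<pi> \<noteq> {}"
  proof
    assume no: "descents n \<pi> = {}"
    have asc': "\<pi> i < \<pi> (Suc i)" if "1 \<le> i" "Suc i < Suc n" for i
    proof -
      have "i \<notin> descents n \<pi>" using no by simp
      moreover have "\<pi> i \<noteq> \<pi> (Suc i)" using permutes_inj[OF perm] by (simp add: inj_eq)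
      ultimately show ?thesis using that by (simp add: descents_def)
    qed
    \<comment> \<open>Without descents the word is the identity word, which would make
      \<open>A\<close> the prefix \<open>{1..k}\<close>.\<close>
    have "sorted_wrt (<) xs" unfolding word[symmetric] by (rule sorted_map_upt_of_ascents) (rule asc')
    then have "xs = [1..<Suc n]"
      by (intro strict_sorted_equal) (auto simp: set simp del: upt_Suc)
    then have "map \<pi> [1..<Suc n] = map id [1..<Suc n]" using word by simp
    then have "\<forall>i \<in> {1..n}. \<pi> i = id i"
      by (simp only: map_eq_conv set_upt atLeastLessThanSuc_atLeastAtMost)
    then have "\<pi> ` {1..k} = {1..k}" using kn by force
    then show False using run A(2) k_def by simp
  qed
  ultimately have "descents n \<pi> = {k}" by blast
  then show ?thesis using perm run by (intro bexI[of _ \<pi>]) (auto simp: one_descent_perms_def first_run_def)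
qed

lemma bij_betw_first_run: "bij_betw (first_run n) (one_descent_perms n) (non_prefix_sets n)"
proof (rule bij_betw_imageI)
  show "inj_on (first_run n) (one_descent_perms n)"
  proof (rule inj_onI)
    fix \<pi> \<sigma> assume p: "\<pi> \<in> one_descent_perms n" and s: "\<sigma> \<in> one_descent_perms n"
      and eq: "first_run n \<pi> = first_run n \<sigma>"
    have "map \<pi> [1..<Suc n] = map \<sigma> [1..<Suc n]"
      using one_descent_perm_word[OF p] one_descent_perm_word[OF s] eq by simp
    then have "\<forall>i \<in> {1..n}. \<pi> i = \<sigma> i" by (simp add: atLeastLessThanSuc_atLeastAtMost del: upt_Suc)
    moreover have "\<pi> permutes {1..n}" "\<sigma> permutes {1..n}" using p s by (auto simp: one_descent_perms_def)
    ultimately show "\<pi> = \<sigma>" unfolding permutes_def by (metis ext)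
  qed
  show "first_run n ` one_descent_perms n = non_prefix_sets n"
    using first_run_in_non_prefix_sets non_prefix_set_is_first_run by blast
qed

section \<open>The ballot condition for one descent\<close>

text \<open>The run has length \<open>k\<close>, the position of the descent. For
  \<open>k = 1\<close> the condition fails at once; otherwise position 1 is an ascent, which offsets
  the single descent in every initial segment.\<close>

lemma ballot_perms_1_eq:
  "ballot_perms n 1 = {\<pi> \<in> one_descent_perms n. 2 \<le> card (first_run n \<pi>)}"
proof -
  have "ballot n \<pi> \<longleftrightarrow> 2 \<le> card (first_run n \<pi>)" if one: "\<pi> \<in> one_descent_perms n" for \<pi>
  proof -
    obtain k where k: "\<pi> permutes {1..n}" "descents n \<pi> = {k}" "1 \<le> k" "k < n" "first_run n \<pi> = \<pi> ` {1..k}"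
        "card (first_run n \<pi>) = k" and asc: "\<forall>i. 1 \<le> i \<and> i < n \<and> i \<noteq> k \<longrightarrow> \<pi> i < \<pi> (Suc i)"
      using one by (rule one_descent_permsE)
    have "k \<in> descents n \<pi>" using k(2) by simp
    then have "ascents n \<pi> = {1..<n} - {k}"
      using asc by (auto simp: ascents_def descents_def)
    then have ballot: "ballot n \<pi> \<longleftrightarrow>
        (\<forall>j \<in> {1..<n}. card ({k} \<inter> {1..j}) \<le> card (({1..<n} - {k}) \<inter> {1..j}))"
      by (simp add: ballot_def k(2))
    show ?thesis
    proof (cases "k = 1")
      case True
      then have "\<not> ballot n \<pi>" unfolding ballot using k(4) by (auto intro!: bexI[of _ 1])
      then show ?thesis using True k(6) by simp
    next
      case False
      have "card ({k} \<inter> {1..j}) \<le> card (({1..<n} - {k}) \<inter> {1..j})" if "j \<in> {1..<n}" for j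
      proof -
        have "1 \<in> ({1..<n} - {k}) \<inter> {1..j}" using that False by auto
        then have "1 \<le> card (({1..<n} - {k}) \<inter> {1..j})"
          by (metis One_nat_def Suc_leI card_gt_0_iff empty_iff finite_Int finite_atLeastAtMost)
        moreover have "card ({k} \<inter> {1..j}) \<le> 1" using card_mono[of "{k}" "{k} \<inter> {1..j}"] by simp
        ultimately show ?thesis by linarith
      qed
      then have "ballot n \<pi>" unfolding ballot by blast
      then show ?thesis using False k(3,6) by simp
    qed
  qed
  then show ?thesis unfolding ballot_perms_def one_descent_perms_def by auto
qed

lemma bij_betw_first_run_ballot:
  "bij_betw (first_run n) (ballot_perms n 1) {A \<in> non_prefix_sets n. 2 \<le> card A}"
  unfolding ballot_perms_1_eq
proof (rule bij_betw_subset[OF bij_betw_first_run])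
  have img: "non_prefix_sets n = first_run n ` one_descent_perms n"
    using bij_betw_first_run by (rule bij_betw_imp_surj_on[symmetric])
  show "first_run n ` {\<pi> \<in> one_descent_perms n. 2 \<le> card (first_run n \<pi>)}
      = {A \<in> non_prefix_sets n. 2 \<le> card A}"
    unfolding img by auto
qed auto

section \<open>Counting the sets of first runs\<close>

text \<open>From the \<open>2 ^ n\<close> subsets the \<open>n + 1\<close> prefixes
  \<open>{1..k}\<close> with \<open>0 \<le> k \<le> n\<close> are removed.\<close>

lemma card_non_prefix_sets: "card (non_prefix_sets n) + (n + 1) = 2 ^ n"
proof -
  let ?P = "(\<lambda>k. {1..k}) ` {0..n}"
  have "non_prefix_sets n = Pow {1..n} - ?P"
  proof
    show "non_prefix_sets n \<subseteq> Pow {1..n} - ?P" by (auto simp: non_prefix_sets_def)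
    show "Pow {1..n} - ?P \<subseteq> non_prefix_sets n"
    proof
      fix A assume A: "A \<in> Pow {1..n} - ?P"
      then have "card A \<in> {0..n}" using card_mono[of "{1..n}" A] by simp
      then show "A \<in> non_prefix_sets n" using A by (auto simp: non_prefix_sets_def)
    qed
  qed
  moreover have sub: "?P \<subseteq> Pow {1..n}" by auto
  moreover have "inj_on (\<lambda>k. {1..k}) {0..n}" by (rule inj_on_inverseI[where g = card]) simp
  then have "card ?P = n + 1" by (simp add: card_image)
  moreover have "card ?P \<le> card (Pow {1..n})" using sub by (intro card_mono) auto
  ultimately show ?thesis by (simp add: card_Diff_subset card_Pow)
qed

text \<open>The sets lost are the singletons \<open>{a}\<close> with
  \<open>2 \<le> a \<le> n\<close>, because the empty set and \<open>{1}\<close> are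
  prefixes.\<close>

lemma card_non_prefix_sets_ge_2:
  "card {A \<in> non_prefix_sets n. 2 \<le> card A} + (n - 1) = card (non_prefix_sets n)"
proof -
  have fin: "finite (non_prefix_sets n)"
    by (rule finite_subset[of _ "Pow {1..n}"]) (auto simp: non_prefix_sets_def)
  have "{A \<in> non_prefix_sets n. card A < 2} = (\<lambda>a. {a}) ` {2..n}"
  proof
    show "{A \<in> non_prefix_sets n. card A < 2} \<subseteq> (\<lambda>a. {a}) ` {2..n}"
    proof
      fix A assume "A \<in> {A \<in> non_prefix_sets n. card A < 2}"
      then have A: "A \<subseteq> {1..n}" "A \<noteq> {1..card A}" "card A < 2" by (auto simp: non_prefix_sets_def)
      have "finite A" using A(1) finite_subset by blast
      then have "card A \<noteq> 0" using A(2) by auto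
      then have "card A = 1" using A(3) by linarith
      then obtain a where "A = {a}" by (meson card_1_singletonE)
      then show "A \<in> (\<lambda>a. {a}) ` {2..n}" using A(1,2) by (cases "a = 1") auto
    qed
  qed (auto simp: non_prefix_sets_def)
  then have "card {A \<in> non_prefix_sets n. card A < 2} = n - 1" by (simp add: card_image)
  moreover have "card (non_prefix_sets n) =
      card {A \<in> non_prefix_sets n. 2 \<le> card A} + card {A \<in> non_prefix_sets n. card A < 2}"
    using fin by (subst card_Un_disjoint[symmetric]) (auto intro!: arg_cong[where f = card])
  ultimately show ?thesis by simp
qed

lemma eulerian_1: "eulerian n 1 = card (non_prefix_sets n)"
  using bij_betw_same_card[OF bij_betw_first_run, of n]
  by (simp add: eulerian_def one_descent_perms_def)

section \<open>The bijection on sets\<close>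

text \<open>The symmetric difference with \<open>{1}\<close>: an involution that changes the parity
  of a finite cardinality.\<close>

definition toggle_one :: "nat set \<Rightarrow> nat set" where
  "toggle_one A = (A - {1}) \<union> ({1} - A)"

lemma toggle_one_toggle_one [simp]: "toggle_one (toggle_one A) = A"
  by (auto simp: toggle_one_def)

lemma card_toggle_one:
  assumes "finite A"
  shows "card (toggle_one A) = (if 1 \<in> A then card A - 1 else card A + 1)"
  using assms by (auto simp: toggle_one_def insert_Diff_if)

lemma toggle_one_subset: "A \<subseteq> {1..n} \<Longrightarrow> 1 \<le> n \<Longrightarrow> toggle_one A \<subseteq> {1..n}"
  by (auto simp: toggle_one_def)

text \<open>A pair consists of the direction of a cycle (\<open>True\<close> for increasing) and its support.\<close>

definition cycle_data :: "nat set \<Rightarrow> bool \<times> nat set" where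
  "cycle_data A = (let a = Max A in
      if odd (card A) then (True, A)
      else if A = {1, a} then (if odd a then (True, {1..a}) else (False, {2..a}))
      else (False, toggle_one A))"

text \<open>The inverse of \<open>cycle_data\<close>. Supports \<open>{1..a}\<close> (increasing)
  and \<open>{2..a}\<close> (decreasing) would lead back to a prefix, so they are sent to
  \<open>{1, a}\<close> instead; the parity of \<open>a\<close> tells them apart.\<close>

definition run_of_data :: "bool \<times> nat set \<Rightarrow> nat set" where
  "run_of_data = (\<lambda>(inc, S).
      if inc then (if S = {1..card S} then {1, card S} else S)
      else (if S = {2..Max S} then {1, Max S} else toggle_one S))"

definition cycle_of_data :: "bool \<times> nat set \<Rightarrow> nat \<Rightarrow> nat" where
  "cycle_of_data = (\<lambda>(inc, S). if inc then inc_cycle S else dec_cycle S)"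

lemma ballot_bij_eq: "ballot_bij n \<pi> = cycle_of_data (cycle_data (first_run n \<pi>))"
  by (simp add: ballot_bij_def cycle_data_def cycle_of_data_def toggle_one_def Let_def)

text \<open>The moved points recover the support, and supports of size at least 3 separate the two
  directions.\<close>

lemma bij_betw_cycle_of_data:
  "bij_betw cycle_of_data (UNIV \<times> odd_sets n) (odd_order_perms_M n 1)"
proof (rule bij_betw_imageI)
  show "inj_on cycle_of_data (UNIV \<times> odd_sets n)"
    using inj_on_inc_cycle[of n] inj_on_dec_cycle[of n] inc_cycle_neq_dec_cycle[of _ n]
    by (auto simp: inj_on_def cycle_of_data_def split: if_splits) metis+
  have "(UNIV :: bool set) \<times> odd_sets n = Pair True ` odd_sets n \<union> Pair False ` odd_sets n"
    by (auto simp: UNIV_bool)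
  then show "cycle_of_data ` (UNIV \<times> odd_sets n) = odd_order_perms_M n 1"
    unfolding odd_order_perms_M_1_eq by (simp add: image_Un image_image cycle_of_data_def)
qed

lemma pair_one_facts:
  assumes "3 \<le> (a::nat)"
  shows "card {1, a} = 2" "Max {1, a} = a" "{1, a} \<noteq> {1..card {1, a}}"
proof -
  show "card {1, a} = 2" "Max {1, a} = a" using assms by auto
  then show "{1, a} \<noteq> {1..card {1, a}}" using assms by auto
qed

lemma cycle_data_pair:
  assumes "3 \<le> a"
  shows "cycle_data {1, a} = (if odd a then (True, {1..a}) else (False, {2..a}))"
  using pair_one_facts[OF assms] by (simp add: cycle_data_def Let_def)

text \<open>\<open>{1, 2}\<close> is a prefix, hence \<open>3 \<le> a\<close> in the pair case. In
  the remaining even case a two-element set containing 1 would be a pair, so such a set has at least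
  4 elements and keeps at least 3 after toggling.\<close>

lemma non_prefix_set_cases:
  assumes "A \<in> non_prefix_sets n" "2 \<le> card A"
  obtains (odd) "odd (card A)" "3 \<le> card A" "cycle_data A = (True, A)"
  | (pair) a where "A = {1, a}" "3 \<le> a" "a \<le> n"
  | (even) "even (card A)" "cycle_data A = (False, toggle_one A)"
      "1 \<in> A \<Longrightarrow> 4 \<le> card A"
proof -
  have A: "A \<subseteq> {1..n}" "A \<noteq> {1..card A}" using assms by (auto simp: non_prefix_sets_def)
  have fin: "finite A" using A(1) finite_subset by blast
  show thesis
  proof (cases "odd (card A)")
    case True
    moreover from this assms(2) have "3 \<le> card A" by (cases "card A = 2") auto
    ultimately show thesis by (intro odd) (simp_all add: cycle_data_def)
  next
    case False
    show thesis
    proof (cases "A = {1, Max A}")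
      case True
      have "Max A \<noteq> 1"
      proof
        assume "Max A = 1"
        then have "A = {1}" using True by simp
        then show False using False by simp
      qed
      moreover have "Max A \<noteq> 2"
      proof
        assume "Max A = 2"
        then have "A = {1, 2}" using True by simp
        then show False using A(2) by auto
      qed
      moreover have "Max A \<in> A" using True by blast
      then have "Max A \<in> {1..n}" using A(1) by blast
      ultimately have "3 \<le> Max A" "Max A \<le> n" by auto
      then show thesis using True by (intro pair)
    next
      case no_pair: False
      have "card A \<noteq> 2" if one: "1 \<in> A"
      proof
        assume "card A = 2"
        then have "card (A - {1}) = 1" using one fin by simp
        then obtain b where "A - {1} = {b}" by (meson card_1_singletonE)
        then have b: "A = {1, b}" using one by auto
        then have "b \<in> {1..n}" using A(1) by blast
        then have "Max A = b" using b by simp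
        then show False using b no_pair by simp
      qed
      moreover have "card A \<noteq> 3" using False by auto
      ultimately have "4 \<le> card A" if "1 \<in> A" using that assms(2) by fastforce
      then show thesis using False no_pair by (intro even) (simp_all add: cycle_data_def Let_def)
    qed
  qed
qed

text \<open>\<open>cycle_data\<close> and \<open>run_of_data\<close> are checked to be mutually
  inverse, each case of one being matched with a case of the other.\<close>

lemma bij_betw_cycle_data:
  assumes "1 \<le> n"
  shows "bij_betw cycle_data {A \<in> non_prefix_sets n. 2 \<le> card A} (UNIV \<times> odd_sets n)"
    (is "bij_betw _ ?D ?T")
proof (rule bij_betw_byWitness[where f' = run_of_data])
  have data: "run_of_data (cycle_data A) = A \<and> cycle_data A \<in> ?T" if AD: "A \<in> ?D" for A
  proof -
    have mem: "A \<in> non_prefix_sets n" "2 \<le> card A" using AD by auto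
    have A: "A \<subseteq> {1..n}" "A \<noteq> {1..card A}" using mem by (auto simp: non_prefix_sets_def)
    have fin: "finite A" using A(1) finite_subset by blast
    from mem show ?thesis
    proof (cases rule: non_prefix_set_cases)
      case odd
      then show ?thesis using A by (simp add: run_of_data_def odd_sets_def)
    next
      case (pair a)
      have max: "Max {2..a} = a" using pair(2) by (auto intro!: Max_eqI)
      show ?thesis
      proof (cases "odd a")
        case True
        then have "cycle_data A = (True, {1..a})" using pair cycle_data_pair[OF pair(2)] by simp
        then show ?thesis using True pair by (simp add: run_of_data_def odd_sets_def)
      next
        case False
        then have "cycle_data A = (False, {2..a})" using pair cycle_data_pair[OF pair(2)] by simp
        \<comment> \<open>An even \<open>a\<close> is thus at least 4, and \<open>{2..a}\<close> has
          the odd size \<open>a - 1\<close>, at least 3.\<close>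
        moreover have "a \<noteq> 3" using False by auto
        then have "{2..a} \<in> odd_sets n" using False pair by (auto simp: odd_sets_def)
        ultimately show ?thesis using pair max by (simp add: run_of_data_def)
      qed
    next
      case even
      \<comment> \<open>Otherwise toggling back would turn \<open>A\<close> into a prefix
        \<open>{1..m}\<close>.\<close>
      have "toggle_one A \<noteq> {2..Max (toggle_one A)}"
      proof
        assume eq: "toggle_one A = {2..Max (toggle_one A)}"
        define m where "m = Max (toggle_one A)"
        have "A = toggle_one {2..m}" using eq m_def by (metis toggle_one_toggle_one)
        then have A': "A = insert 1 {2..m}" by (auto simp: toggle_one_def)
        then have "2 \<le> m" using mem(2) by (cases "2 \<le> m") auto
        then have "A = {1..m}" using A' by auto
        then show False using A(2) by simp
      qed
      moreover have "toggle_one A \<in> odd_sets n"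
        using even(1,3) mem(2) toggle_one_subset[OF A(1) assms]
        by (auto simp: odd_sets_def card_toggle_one[OF fin])
      ultimately show ?thesis using even(2) by (simp add: run_of_data_def)
    qed
  qed
  have run: "cycle_data (run_of_data p) = p \<and> run_of_data p \<in> ?D" if pT: "p \<in> ?T" for p
  proof -
    obtain inc S where p: "p = (inc, S)" by (cases p)
    have S: "S \<subseteq> {1..n}" "odd (card S)" "3 \<le> card S" using pT p by (auto simp: odd_sets_def)
    have fin: "finite S" using S(1) finite_subset by blast
    have card_le: "card S \<le> n" using card_mono[OF _ S(1)] by simp
    have pair: "{1, a} \<in> ?D" if "3 \<le> a" "a \<le> n" for a
      using that pair_one_facts[OF that(1)] by (auto simp: non_prefix_sets_def)
    consider "inc" "S = {1..card S}" | "inc" "S \<noteq> {1..card S}"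
      | "\<not> inc" "S = {2..Max S}" | "\<not> inc" "S \<noteq> {2..Max S}" by blast
    then show ?thesis
    proof cases
      case 1
      then have "run_of_data p = {1, card S}" by (simp add: run_of_data_def p)
      moreover have "cycle_data {1, card S} = p"
        using cycle_data_pair[OF S(3)] 1 S(2) p by simp
      ultimately show ?thesis using pair[OF S(3) card_le] by (simp only:)
    next
      case 2
      then have "run_of_data p = S" by (simp add: run_of_data_def p)
      then show ?thesis using 2 S p by (simp add: cycle_data_def non_prefix_sets_def)
    next
      case 3
      define m where "m = Max S"
      have Sm: "S = {2..m}" using 3(2) m_def by simp
      then have m: "3 \<le> m" "even m" using S(2,3) by auto
      have "m \<in> S" using m Sm by simp
      then have "m \<le> n" using S(1) by auto
      have "run_of_data p = {1, m}" using 3 by (simp add: run_of_data_def p m_def)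
      moreover have "cycle_data {1, m} = p"
        using cycle_data_pair[OF m(1)] 3(1) m(2) p Sm by simp
      ultimately show ?thesis using pair[OF m(1) \<open>m \<le> n\<close>] by (simp only:)
    next
      case 4
      let ?A = "toggle_one S"
      have run: "run_of_data p = ?A" using 4 by (simp add: run_of_data_def p)
      have even: "even (card ?A)" and ge: "2 \<le> card ?A"
        using S(2,3) by (auto simp: card_toggle_one[OF fin])
      \<comment> \<open>If 1 is in \<open>?A\<close>, toggling has added it to \<open>S\<close>, so
        \<open>?A\<close> has at least 4 elements.\<close>
      have "?A \<noteq> {1, Max ?A}"
      proof
        assume eq: "?A = {1, Max ?A}"
        then have "1 \<in> ?A" by blast
        then have "1 \<notin> S" by (auto simp: toggle_one_def)
        then have "card ?A = card S + 1" by (simp add: card_toggle_one[OF fin])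
        moreover have "card {1, Max ?A} \<le> 2" by (simp add: card_insert_if)
        then have "card ?A \<le> 2" using eq by simp
        ultimately show False using S(3) by simp
      qed
      then have "cycle_data ?A = (False, S)" using even by (simp add: cycle_data_def Let_def)
      \<comment> \<open>A prefix \<open>{1..j}\<close> toggles to \<open>{2..j}\<close>, the support
        excluded in this case.\<close>
      moreover have "?A \<noteq> {1..card ?A}"
      proof
        assume eq: "?A = {1..card ?A}"
        define j where "j = card ?A"
        have "S = toggle_one {1..j}" using eq j_def by (metis toggle_one_toggle_one)
        moreover have j: "2 \<le> j" using ge j_def by simp
        ultimately have Sj: "S = {2..j}" by (auto simp: toggle_one_def)
        then have "Max S = j" using j by (auto intro!: Max_eqI)
        then show False using 4(2) Sj by simp
      qed
      ultimately show ?thesis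
        using run 4(1) p ge toggle_one_subset[OF S(1) assms] by (simp add: non_prefix_sets_def)
    qed
  qed
  show "\<forall>A \<in> ?D. run_of_data (cycle_data A) = A" "cycle_data ` ?D \<subseteq> ?T" using data by blast+
  show "\<forall>p \<in> ?T. cycle_data (run_of_data p) = p" "run_of_data ` ?T \<subseteq> ?D" using run by blast+
qed

theorem theorem1p3:
  fixes n :: nat
  assumes "n \<ge> 1"
  shows "card (ballot_perms n 1) = card (odd_order_perms_M n 1)
    \<and> card (odd_order_perms_M n 1) = 2 * eulerian (n - 1) 1
    \<and> bij_betw (ballot_bij n) (ballot_perms n 1) (odd_order_perms_M n 1)"
proof -
  have "bij_betw (cycle_of_data \<circ> (cycle_data \<circ> first_run n)) (ballot_perms n 1) (odd_order_perms_M n 1)"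
    by (intro bij_betw_trans[OF bij_betw_trans[OF bij_betw_first_run_ballot bij_betw_cycle_data[OF assms]]]
        bij_betw_cycle_of_data)
  moreover have "cycle_of_data \<circ> (cycle_data \<circ> first_run n) = ballot_bij n"
    by (simp add: fun_eq_iff ballot_bij_eq)
  ultimately have bij: "bij_betw (ballot_bij n) (ballot_perms n 1) (odd_order_perms_M n 1)" by simp
  \<comment> \<open>The ballot count is \<open>2 ^ n - 2 * n\<close> and the Eulerian number is
    \<open>2 ^ (n - 1) - n\<close>; the additive form avoids truncated subtraction.\<close>
  have "card (ballot_perms n 1) + (n - 1) + (n + 1) = 2 ^ n"
    using bij_betw_same_card[OF bij_betw_first_run_ballot, of n] card_non_prefix_sets_ge_2[of n]
      card_non_prefix_sets[of n] by simp
  moreover have "2 * (eulerian (n - 1) 1 + n) = 2 * 2 ^ (n - 1)"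
    using card_non_prefix_sets[of "n - 1"] eulerian_1[of "n - 1"] assms
    by (metis le_add_diff_inverse2)
  moreover have "2 * 2 ^ (n - 1) = (2 ^ n :: nat)" using assms by (simp flip: power_Suc)
  ultimately have "card (ballot_perms n 1) = 2 * eulerian (n - 1) 1" using assms by presburger
  then show ?thesis using bij bij_betw_same_card[OF bij] by simp
qed

end
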